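(* Assume the setting described in the context, with $\delta>0$. Fix $\bar x\in X$, and suppose that $g(\bar x,\cdot)$ is convex on $Y$ and satisfies the following property at $x=\bar x$: (P) if $y_0,y_1\in Y$ and $t\mapsto g(x,(1-t)y_0+ty_1)$ is affine on $[0,1]$, then $t\mapsto g(x,(1-t)y_0+ty_1)$ is constant on $[0,1]$. Then $0\notin\nabla R(\bar x,y)+N_C(\bar x,y)$ for every $y\in Y$ such that $R(\bar x,y)\ge0$. Consequently, if $g(x,\cdot)$ is convex on $Y$ and satisfies (P) for every $x\in X$, then ENNAMCQ holds on $X\times Y$, i.e. $0\notin\nabla R(w)+N_C(w)$ for every $w\in C$ with $R(w)\ge0$. In particular, if $g(x,\cdot)+\iota_Y$ is strictly convex for all $x\in X$ (where $\iota_Y$ is the indicator function of $Y$), then ENNAMCQ holds on $X\times Y$.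
   Context: Setting. $X\subset\mathbb R^n$ and $Y\subset\mathbb R^m$ are nonempty, compact, convex; $C=X\times Y$. The function $g$ is real-valued, continuously differentiable on a neighborhood of $C$, with $\nabla g$ Lipschitz on $C$. $\sigma\ge0$ is such that $g(x,\cdot)+\frac\sigma2\|\cdot\|^2$ is convex on $Y$ for every $x\in X$; $\rho>0$ satisfies $\rho\sigma<1$. Put $g_\rho(x,y)=\min_{z\in Y}\{g(x,z)+\frac1{2\rho}\|z-y\|^2\}$, with unique minimizer $z_\rho(x,y)$, and $R(x,y)=g(x,y)-g_\rho(x,y)-\delta$. $R$ is continuously differentiable on $C$ with $\nabla R(x,y)=\bigl(\nabla_xg(x,y)-\nabla_xg(x,z_\rho(x,y)),\ \nabla_yg(x,y)-\rho^{-1}(y-z_\rho(x,y))\bigr)$. $N_C$ denotes the normal cone to $C$ in the sense of convex analysis. *)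

theory Defs
  imports "HOL-Analysis.Analysis"
begin

(* Unspecified where f is not differentiable. *)
definition grad :: "('a::real_inner \<Rightarrow> real) \<Rightarrow> 'a \<Rightarrow> 'a" where
  "grad f x = (THE D. GDERIV f x :> D)"

lemma grad_eqI:
  assumes "GDERIV f x :> D"
  shows "grad f x = D"
  unfolding grad_def
using assms
proof (rule the_equality)
  fix E assume "GDERIV f x :> E"
  with assms have "(\<lambda>h. inner h E) = (\<lambda>h. inner h D)"
    unfolding gderiv_def by (metis has_derivative_unique)
  then have "\<forall>h. inner h (E - D) = 0"
    by (simp add: fun_eq_iff inner_diff_right)
  then have "inner (E - D) (E - D) = 0" by blast
  then show "E = D" by simp
qed

definition normal_cone :: "'a::real_inner set \<Rightarrow> 'a \<Rightarrow> 'a set" where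
  "normal_cone C w = (if w \<in> C then {v. \<forall>u\<in>C. inner v (u - w) \<le> 0} else {})"

(* The partial Moreau envelope in y over Y. When Y is compact and nonempty and g(x,.) is
   continuous on Y, the infimum is a minimum. It is defined for all pairs (x,y), so that it
   can be differentiated at boundary points of the domain X x Y. *)
definition envelope ::
    "'b::real_normed_vector set \<Rightarrow> ('a \<times> 'b \<Rightarrow> real) \<Rightarrow> real \<Rightarrow> 'a \<times> 'b \<Rightarrow> real" where
  "envelope Y g \<rho> = (\<lambda>(x, y). INF z\<in>Y. g (x, z) + 1 / (2 * \<rho>) * (norm (z - y))\<^sup>2)"

definition residual ::
    "'b::real_normed_vector set \<Rightarrow> ('a \<times> 'b \<Rightarrow> real) \<Rightarrow> real \<Rightarrow> real \<Rightarrow> 'a \<times> 'b \<Rightarrow> real" where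
  "residual Y g \<rho> \<delta> = (\<lambda>w. g w - envelope Y g \<rho> w - \<delta>)"

definition ENNAMCQ :: "'a::real_inner set \<Rightarrow> ('a \<Rightarrow> real) \<Rightarrow> bool" where
  "ENNAMCQ C R \<longleftrightarrow> (\<forall>w\<in>C. R w \<ge> 0 \<longrightarrow> 0 \<notin> {grad R w + v | v. v \<in> normal_cone C w})"

definition affine_fun_on :: "real set \<Rightarrow> (real \<Rightarrow> real) \<Rightarrow> bool" where
  "affine_fun_on T f \<longleftrightarrow> (\<exists>a b. \<forall>t\<in>T. f t = a + b * t)"

(* Property (P), for a function h = g(x,.). *)
definition affine_segments_constant :: "'b::real_vector set \<Rightarrow> ('b \<Rightarrow> real) \<Rightarrow> bool" where
  "affine_segments_constant Y h \<longleftrightarrow>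
     (\<forall>y0\<in>Y. \<forall>y1\<in>Y.
        affine_fun_on {0..1} (\<lambda>t. h ((1 - t) *\<^sub>R y0 + t *\<^sub>R y1)) \<longrightarrow>
        (\<lambda>t. h ((1 - t) *\<^sub>R y0 + t *\<^sub>R y1)) constant_on {0..1})"

definition indicator_fun :: "'b set \<Rightarrow> 'b \<Rightarrow> ereal" where
  "indicator_fun Y y = (if y \<in> Y then 0 else \<infinity>)"

(* Strict convexity of an extended-real-valued function: the inequality is required to be
   strict between distinct points of the effective domain. *)
definition strictly_convex :: "('b::real_vector \<Rightarrow> ereal) \<Rightarrow> bool" where
  "strictly_convex f \<longleftrightarrow>
     (\<forall>y0 y1. \<forall>t\<in>{0<..<1}. y0 \<noteq> y1 \<and> f y0 < \<infinity> \<and> f y1 < \<infinity> \<longrightarrow>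
        f ((1 - t) *\<^sub>R y0 + t *\<^sub>R y1) < ereal (1 - t) * f y0 + ereal t * f y1)"

end

theory Submission
  imports Defs
begin

text \<open>
  Write \<open>\<phi> (x, y) z\<close> for the objective defining the envelope. For convex \<open>g(x,\<cdot>)\<close> its minimiser
  \<open>z\<close> over \<open>Y\<close> is unique, so Danskin's theorem gives the gradient of the residual. Put
  \<open>c = -|y - z|\<^sup>2 / \<rho>\<close> and \<open>h t = g (x, y + t (z - y))\<close>. Testing stationarity of \<open>(x, y)\<close> with the
  direction \<open>(0, z - y)\<close> gives \<open>c \<le> h' 0\<close>, and optimality of \<open>z\<close> gives \<open>h' 1 \<le> c\<close>. As \<open>h\<close> is
  convex, it is affine with slope \<open>c\<close>; by (P) it is constant, hence \<open>c = 0\<close> and \<open>z = y\<close>. But then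
  the residual equals \<open>-\<delta> < 0\<close>.
\<close>

section \<open>Gradients and differentiation of an infimum over a compact set\<close>

text \<open>Riesz representation: the vector is the adjoint of the derivative applied to 1, and
  \<open>grad_eqI\<close> identifies it with the definite description \<open>grad\<close>.\<close>

lemma differentiable_GDERIV_grad:
  fixes f :: "'a::euclidean_space \<Rightarrow> real"
  assumes "f differentiable (at x)"
  shows "GDERIV f x :> grad f x"
proof -
  obtain f' where f': "(f has_derivative f') (at x)"
    using assms by (auto simp: differentiable_def)
  have "f' = (\<lambda>h. inner h (adjoint f' 1))"
    using adjoint_works[OF has_derivative_linear[OF f'], of _ 1] by (simp add: fun_eq_iff)
  then have "GDERIV f x :> adjoint f' 1"
    using f' unfolding gderiv_def by simp
  then show ?thesis
    using grad_eqI by metis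
qed

text \<open>Otherwise there are points tending to \<open>w0\<close> whose minimisers stay at
  distance at least \<open>r\<close> from \<open>z0\<close>. By compactness these minimisers
  accumulate at some \<open>l\<close>, joint continuity makes \<open>l\<close> a minimiser at
  \<open>w0\<close>, and uniqueness forces \<open>l = z0\<close>.\<close>

lemma compact_argmin_near:
  fixes \<phi> :: "'a::metric_space \<Rightarrow> 'b::metric_space \<Rightarrow> real"
  assumes Z: "compact Z" and W: "open W" "w0 \<in> W" and r: "r > 0"
    and cont: "continuous_on (W \<times> Z) (\<lambda>(w, z). \<phi> w z)"
    and z0: "z0 \<in> Z"
    and uniq: "\<And>z. z \<in> Z \<Longrightarrow> (\<And>u. u \<in> Z \<Longrightarrow> \<phi> w0 z \<le> \<phi> w0 u) \<Longrightarrow> z = z0"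
  shows "\<exists>d>0. \<forall>w z. dist w w0 < d \<longrightarrow> z \<in> Z \<longrightarrow> (\<forall>u\<in>Z. \<phi> w z \<le> \<phi> w u) \<longrightarrow> dist z z0 < r"
proof (rule ccontr)
  assume neg: "\<not> ?thesis"
  obtain e where e: "e > 0" "ball w0 e \<subseteq> W"
    using W open_contains_ball by blast
  \<comment> \<open>The radii \<open>e / Suc n\<close> tend to 0 and never exceed \<open>e\<close>,
    so the whole sequence stays inside \<open>W\<close>, where continuity is available.\<close>
  have "\<exists>w z. dist w w0 < e / Suc n \<and> z \<in> Z \<and> (\<forall>u\<in>Z. \<phi> w z \<le> \<phi> w u) \<and> \<not> dist z z0 < r" for n
  proof -
    have "e / Suc n > 0" using e(1) by simp
    then show ?thesis using neg by blast
  qed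
  then obtain w z where wz: "\<And>n. dist (w n) w0 < e / Suc n" "\<And>n. z n \<in> Z"
      "\<And>n u. u \<in> Z \<Longrightarrow> \<phi> (w n) (z n) \<le> \<phi> (w n) u" "\<And>n. r \<le> dist (z n) z0"
    by (metis not_less)
  have "(\<lambda>n. e / Suc n) \<longlonglongrightarrow> 0"
    using tendsto_mult_right_zero[OF LIMSEQ_inverse_real_of_nat, of e]
    by (simp add: divide_inverse)
  then have wlim: "w \<longlonglongrightarrow> w0"
    unfolding tendsto_dist_iff[of w]
    by (rule Lim_null_comparison[rotated]) (use less_imp_le[OF wz(1)] in auto)
  have "e / Suc n \<le> e" for n
    using e(1) by (simp add: field_simps)
  then have wW: "w n \<in> W" for n
    using wz(1)[of n] e(2) by (force simp: dist_commute intro: less_le_trans)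
  obtain l s where l: "l \<in> Z" "strict_mono s" "(z \<circ> s) \<longlonglongrightarrow> l"
    using Z wz(2) unfolding compact_eq_seq_compact_metric seq_compact_def by metis
  have ws: "(w \<circ> s) \<longlonglongrightarrow> w0"
    using wlim l(2) by (rule LIMSEQ_subseq_LIMSEQ)
  \<comment> \<open>Used twice below: for the extracted minimisers and for a constant competitor
    \<open>u\<close>.\<close>
  have lim: "(\<lambda>n. \<phi> (w (s n)) (v n)) \<longlonglongrightarrow> \<phi> w0 v0"
    if "v \<longlonglongrightarrow> v0" "\<And>n. v n \<in> Z" "v0 \<in> Z" for v v0
    using continuous_on_tendsto_compose[OF cont tendsto_Pair[OF ws that(1)]] that(2,3) wW W(2)
    by (simp add: o_def)
  have "\<phi> w0 l \<le> \<phi> w0 u" if u: "u \<in> Z" for u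
    by (rule LIMSEQ_le[OF lim[OF l(3)] lim[of "\<lambda>_. u"]]) (use u l wz in auto)
  then have "l = z0" using uniq l(1) by blast
  moreover have "r \<le> dist l z0"
    by (rule LIMSEQ_le_const[OF tendsto_dist[OF l(3) tendsto_const]]) (use wz(4) in auto)
  ultimately show False using r by simp
qed

text \<open>Danskin's theorem. At a nearby point \<open>w\<close> the increment of the infimum lies between the increments
  of \<open>\<phi> \<cdot> z\<close> for \<open>z\<close> the minimiser at \<open>w\<close> and for \<open>z = z0\<close>.\<close>

lemma GDERIV_INF_unique_argmin:
  fixes \<phi> :: "'a::real_inner \<Rightarrow> 'b::metric_space \<Rightarrow> real"
  assumes Z: "compact Z" and W: "open W" "w0 \<in> W"
    and cont: "continuous_on (W \<times> Z) (\<lambda>(w, z). \<phi> w z)"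
    and deriv: "\<And>w z. w \<in> W \<Longrightarrow> z \<in> Z \<Longrightarrow> GDERIV (\<lambda>w. \<phi> w z) w :> G w z"
    and contG: "continuous_on (W \<times> Z) (\<lambda>(w, z). G w z)"
    and z0: "z0 \<in> Z" "\<And>u. u \<in> Z \<Longrightarrow> \<phi> w0 z0 \<le> \<phi> w0 u"
    and uniq: "\<And>z. z \<in> Z \<Longrightarrow> (\<And>u. u \<in> Z \<Longrightarrow> \<phi> w0 z \<le> \<phi> w0 u) \<Longrightarrow> z = z0"
  shows "GDERIV (\<lambda>w. INF z\<in>Z. \<phi> w z) w0 :> G w0 z0"
  unfolding gderiv_def has_derivative_at_alt
proof (intro conjI allI impI)
  show "bounded_linear (\<lambda>h. inner h (G w0 z0))"
    by (rule bounded_linear_inner_left)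
  fix e :: real assume e: "e > 0"
  define E where "E w = (INF z\<in>Z. \<phi> w z)" for w
  have E_eq: "E w = \<phi> w z" if "z \<in> Z" "\<And>u. u \<in> Z \<Longrightarrow> \<phi> w z \<le> \<phi> w u" for w z
    unfolding E_def using that by (intro cInf_eq_minimum) auto
  have contz: "continuous_on Z (\<phi> w)" if "w \<in> W" for w
    using continuous_on_compose2[OF cont, where f = "\<lambda>z. (w, z)" and s = Z] that
    by (simp add: image_subset_iff continuous_on_Pair)
  have argmin: "\<exists>z\<in>Z. \<forall>u\<in>Z. \<phi> w z \<le> \<phi> w u" if "w \<in> W" for w
    using continuous_attains_inf[OF Z _ contz[OF that]] z0(1) by auto
  obtain a where a: "a > 0" "\<And>w z. w \<in> W \<Longrightarrow> z \<in> Z \<Longrightarrow> dist (w, z) (w0, z0) < a \<Longrightarrow>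
      dist (G w z) (G w0 z0) < e"
    using contG[unfolded continuous_on_iff, rule_format, of "(w0, z0)" e] e W(2) z0(1)
    by auto
  obtain b where b: "b > 0" "ball w0 b \<subseteq> W"
    using W open_contains_ball by blast
  obtain d where d: "d > 0" "\<And>w z. dist w w0 < d \<Longrightarrow> z \<in> Z \<Longrightarrow> (\<And>u. u \<in> Z \<Longrightarrow> \<phi> w z \<le> \<phi> w u) \<Longrightarrow>
      dist z z0 < a / 2"
    using compact_argmin_near[OF Z W half_gt_zero[OF a(1)] cont z0(1) uniq] by metis
  \<comment> \<open>Mean value inequality for \<open>\<phi> v z\<close> minus a linear map fixed at
    \<open>(w0, z0)\<close>. The bound is uniform in \<open>z\<close> near \<open>z0\<close>, so
    \<open>z\<close> may later depend on \<open>w\<close>. The two radii \<open>a / 2\<close> add up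
    to the radius \<open>a\<close> of continuity of \<open>G\<close>.\<close>
  have incr: "\<bar>\<phi> w z - \<phi> w0 z - inner (w - w0) (G w0 z0)\<bar> \<le> e * norm (w - w0)"
    if w: "w \<in> ball w0 (min b (a / 2))" and z: "z \<in> Z" "dist z z0 < a / 2" for w z
  proof -
    let ?B = "ball w0 (min b (a / 2))"
    let ?f = "\<lambda>v. \<phi> v z - inner v (G w0 z0)"
    have "norm (?f w - ?f w0) \<le> e * norm (w - w0)"
    proof (rule differentiable_bound[where S = ?B and f' = "\<lambda>v h. inner h (G v z - G w0 z0)"])
      fix v assume v: "v \<in> ?B"
      then have vW: "v \<in> W" using b(2) by auto
      show "(?f has_derivative (\<lambda>h. inner h (G v z - G w0 z0))) (at v within ?B)"
        using deriv[OF vW z(1)] unfolding gderiv_def inner_diff_right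
        by (intro has_derivative_at_withinI[where s = ?B] has_derivative_diff
            bounded_linear_imp_has_derivative bounded_linear_inner_left) auto
      have "dist (v, z) (w0, z0) \<le> dist v w0 + dist z z0"
        by (simp add: dist_Pair_Pair sqrt_sum_squares_le_sum)
      also have "\<dots> < a" using v z by (auto simp: dist_commute)
      finally have "norm (G v z - G w0 z0) \<le> e"
        using a(2)[OF vW z(1)] by (simp add: dist_norm)
      then show "onorm (\<lambda>h. inner h (G v z - G w0 z0)) \<le> e"
        using e by (intro onorm_bound)
          (auto simp: mult.commute[of e] intro!: order_trans[OF Cauchy_Schwarz_ineq2] mult_left_mono)
    qed (use w b(1) a(1) in auto)
    then show ?thesis by (simp add: inner_diff_left algebra_simps)
  qed
  show "\<exists>d>0. \<forall>y. norm (y - w0) < d \<longrightarrow>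
      norm ((INF z\<in>Z. \<phi> y z) - (INF z\<in>Z. \<phi> w0 z) - inner (y - w0) (G w0 z0)) \<le> e * norm (y - w0)"
  proof (intro exI[of _ "min d (min b (a / 2))"] conjI allI impI)
    show "0 < min d (min b (a / 2))" using a b d by auto
    fix w assume w: "norm (w - w0) < min d (min b (a / 2))"
    then have wB: "w \<in> ball w0 (min b (a / 2))" and wd: "dist w w0 < d"
      by (auto simp: dist_norm norm_minus_commute)
    then have "w \<in> W" using b(2) by auto
    then obtain z where z: "z \<in> Z" "\<And>u. u \<in> Z \<Longrightarrow> \<phi> w z \<le> \<phi> w u" using argmin by blast
    have "\<bar>\<phi> w z - \<phi> w0 z - inner (w - w0) (G w0 z0)\<bar> \<le> e * norm (w - w0)"
      using incr[OF wB z(1) d(2)[OF wd z]] .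
    moreover have "\<bar>\<phi> w z0 - \<phi> w0 z0 - inner (w - w0) (G w0 z0)\<bar> \<le> e * norm (w - w0)"
      using incr[OF wB z0(1)] a(1) by simp
    moreover have "E w = \<phi> w z" "E w0 = \<phi> w0 z0" by (intro E_eq z z0; assumption)+
    moreover have "\<phi> w z \<le> \<phi> w z0" "\<phi> w0 z0 \<le> \<phi> w0 z" using z z0 by auto
    ultimately show "norm ((INF z\<in>Z. \<phi> w z) - (INF z\<in>Z. \<phi> w0 z) - inner (w - w0) (G w0 z0))
        \<le> e * norm (w - w0)"
      unfolding E_def[symmetric] real_norm_def by linarith
  qed
qed

section \<open>First-order inequalities and uniqueness of the proximal point\<close>

text \<open>The difference quotients along \<open>v\<close> are bounded by \<open>c\<close> for
  small positive \<open>t\<close>, so their limit is too. Only the ray on one side is tested, which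
  suits boundary points of a convex set. It serves both the tangent inequality and the optimality
  condition of a minimiser.\<close>

lemma GDERIV_le_of_chord_le:
  assumes D: "GDERIV f y :> D"
    and le: "\<And>t. t \<in> {0<..<1} \<Longrightarrow> f (y + t *\<^sub>R v) \<le> f y + t * c"
  shows "inner D v \<le> c"
proof -
  have "((\<lambda>t. f (y + t *\<^sub>R v)) has_derivative (\<lambda>t. inner (t *\<^sub>R v) D)) (at 0)"
    using D unfolding gderiv_def
    by (intro has_derivative_compose[of "\<lambda>t. y + t *\<^sub>R v" "\<lambda>t. t *\<^sub>R v" 0 UNIV f "\<lambda>h. inner h D"])
      (auto intro!: derivative_eq_intros)
  then have "((\<lambda>t. f (y + t *\<^sub>R v)) has_real_derivative inner D v) (at 0)"
    by (rule has_derivative_imp_has_field_derivative) (simp add: inner_commute)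
  then have "((\<lambda>t. (f (y + t *\<^sub>R v) - f y) / t) \<longlongrightarrow> inner D v) (at_right 0)"
    unfolding has_field_derivative_iff by (auto intro: tendsto_within_subset)
  moreover have "\<forall>\<^sub>F t in at_right 0. (f (y + t *\<^sub>R v) - f y) / t \<le> c"
    unfolding eventually_at_right_field
    by (intro exI[of _ 1]) (use le in \<open>force simp: field_simps\<close>)
  ultimately show ?thesis
    by (rule tendsto_upperbound) simp
qed

lemma convex_on_above_GDERIV:
  assumes f: "convex_on S f" and y: "y \<in> S" "z \<in> S" and D: "GDERIV f y :> D"
  shows "f y + inner D (z - y) \<le> f z"
proof -
  have "f (y + t *\<^sub>R (z - y)) \<le> f y + t * (f z - f y)" if "t \<in> {0<..<1}" for t
    using convex_onD[OF f, of t y z] that y by (simp add: algebra_simps)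
  then have "inner D (z - y) \<le> f z - f y" by (rule GDERIV_le_of_chord_le[OF D])
  then show ?thesis by simp
qed

text \<open>Compare both minimisers with their midpoint: by the parallelogram identity the quadratic
  term there lies strictly below the average unless the two points coincide, while convexity keeps
  \<open>f\<close> from exceeding its average.\<close>

lemma convex_on_prox_minimiser_unique:
  fixes f :: "'a::real_inner \<Rightarrow> real"
  assumes f: "convex_on S f" and \<rho>: "\<rho> > 0" and S: "z0 \<in> S" "z1 \<in> S"
    and min0: "\<And>u. u \<in> S \<Longrightarrow> f z0 + 1 / (2 * \<rho>) * (norm (z0 - y))\<^sup>2 \<le> f u + 1 / (2 * \<rho>) * (norm (u - y))\<^sup>2"
    and min1: "\<And>u. u \<in> S \<Longrightarrow> f z1 + 1 / (2 * \<rho>) * (norm (z1 - y))\<^sup>2 \<le> f u + 1 / (2 * \<rho>) * (norm (u - y))\<^sup>2"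
  shows "z1 = z0"
proof -
  let ?m = "(1 - 1/2) *\<^sub>R z0 + (1/2) *\<^sub>R z1"
  let ?k = "1 / (2 * \<rho>)"
  have m: "?m \<in> S"
    using convex_on_imp_convex[OF f] S by (intro convexD_alt) auto
  have fm: "f ?m \<le> (1 - 1/2) * f z0 + 1/2 * f z1"
    using f S by (intro convex_onD) auto
  have par: "(norm (?m - y))\<^sup>2 = (norm (z0 - y))\<^sup>2 / 2 + (norm (z1 - y))\<^sup>2 / 2 - (norm (z1 - z0))\<^sup>2 / 4"
    unfolding power2_norm_eq_inner
    by (simp add: inner_diff_left inner_diff_right inner_add_left inner_add_right inner_commute field_simps)
  have "?k * (norm (z1 - z0))\<^sup>2 \<le> 0"
    using min0[OF m] min1[OF m] fm unfolding par by (simp add: algebra_simps)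
  moreover have "?k > 0" using \<rho> by simp
  ultimately have "(norm (z1 - z0))\<^sup>2 \<le> 0"
    by (simp add: divide_le_0_iff)
  then show ?thesis by simp
qed

section \<open>Gradient and stationarity of the residual\<close>

text \<open>Danskin's theorem for the proximal objective, with convexity of
  \<open>g (x, \<cdot>)\<close> supplying the unique minimiser at \<open>(x, y)\<close>. The
  parameter \<open>w\<close> ranges over a full neighbourhood of \<open>(x, y)\<close>, so boundary
  points of the domain are covered.\<close>

lemma GDERIV_residual:
  fixes x :: "'a::euclidean_space" and Y :: "'b::euclidean_space set"
  assumes Y: "compact Y"
    and U: "open U" "{x} \<times> Y \<subseteq> U"
    and g_C1: "\<And>w. w \<in> U \<Longrightarrow> g differentiable (at w)" "continuous_on U (grad g)"
    and conv: "convex_on Y (\<lambda>y. g (x, y))"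
    and \<rho>: "\<rho> > 0" and y: "y \<in> Y" and z: "z \<in> Y"
    and min: "\<And>u. u \<in> Y \<Longrightarrow>
      g (x, z) + 1 / (2 * \<rho>) * (norm (z - y))\<^sup>2 \<le> g (x, u) + 1 / (2 * \<rho>) * (norm (u - y))\<^sup>2"
  shows "GDERIV (residual Y g \<rho> \<delta>) (x, y) :> grad g (x, y) - (fst (grad g (x, z)), (1 / \<rho>) *\<^sub>R (y - z))"
proof -
  define \<phi> where "\<phi> w z = g (fst w, z) + 1 / (2 * \<rho>) * (norm (z - snd w))\<^sup>2" for w :: "'a \<times> 'b" and z
  define G where "G w z = (fst (grad g (fst w, z)), (1 / \<rho>) *\<^sub>R (snd w - z))" for w :: "'a \<times> 'b" and z
  \<comment> \<open>By compactness of \<open>Y\<close>, one neighbourhood of \<open>x\<close> keeps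
    \<open>g\<close> differentiable at every competitor \<open>z\<close> simultaneously. The second
    component of \<open>w\<close> enters only through the quadratic and is left free.\<close>
  obtain X0 where X0: "x \<in> X0" "open X0" "X0 \<times> Y \<subseteq> U"
    using Elementary_Topology.tube_lemma[OF Y U] by auto
  let ?W = "X0 \<times> (UNIV :: 'b set)"
  have g_der: "(g has_derivative (\<lambda>h. inner h (grad g w))) (at w)" if "w \<in> U" for w
    using differentiable_GDERIV_grad[OF g_C1(1)[OF that]] unfolding gderiv_def .
  have contg: "continuous_on U g"
    using g_C1(1) by (meson differentiable_imp_continuous_within continuous_at_imp_continuous_on)
  have comp: "continuous_on (?W \<times> Y) (\<lambda>p. f (fst (fst p), snd p))"
    if "continuous_on U f" for f :: "'a \<times> 'b \<Rightarrow> 'c::topological_space"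
    by (rule continuous_on_compose2[OF that, where f = "\<lambda>p. (fst (fst p), snd p)"])
      (use X0(3) in \<open>auto intro!: continuous_intros\<close>)
  have cont: "continuous_on (?W \<times> Y) (\<lambda>(w, z). \<phi> w z)"
    unfolding \<phi>_def case_prod_beta by (intro continuous_intros comp[OF contg])
  have contG: "continuous_on (?W \<times> Y) (\<lambda>(w, z). G w z)"
    unfolding G_def case_prod_beta by (intro continuous_intros comp[OF g_C1(2)])
  have deriv: "GDERIV (\<lambda>w. \<phi> w z) w :> G w z" if w: "w \<in> ?W" and z: "z \<in> Y" for w z
  proof -
    have "(fst w, z) \<in> U" using w z X0(3) by auto
    from has_derivative_compose[of "\<lambda>w. (fst w, z)" "\<lambda>h. (fst h, 0)" w UNIV, OF _ g_der[OF this]]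
    have "((\<lambda>w. g (fst w, z)) has_derivative (\<lambda>h. inner (fst h) (fst (grad g (fst w, z))))) (at w)"
      by (simp add: inner_prod_def
          has_derivative_Pair[OF has_derivative_fst[OF has_derivative_ident] has_derivative_const])
    then show ?thesis
      unfolding gderiv_def \<phi>_def G_def power2_norm_eq_inner using \<rho>
      by (auto intro!: derivative_eq_intros simp: inner_prod_def inner_commute inner_diff_left inner_diff_right field_simps)
  qed
  have "GDERIV (\<lambda>w. INF z\<in>Y. \<phi> w z) (x, y) :> G (x, y) z"
  proof (rule GDERIV_INF_unique_argmin[OF Y _ _ cont deriv contG z])
    show "open ?W" using X0(2) by (intro open_Times) auto
    show "(x, y) \<in> ?W" using X0(1) by simp
    show "\<phi> (x, y) z \<le> \<phi> (x, y) u" if "u \<in> Y" for u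
      using min[OF that] by (simp add: \<phi>_def)
    show "z' = z" if "z' \<in> Y" "\<And>u. u \<in> Y \<Longrightarrow> \<phi> (x, y) z' \<le> \<phi> (x, y) u" for z'
      using convex_on_prox_minimiser_unique[OF conv \<rho> z that(1) min] that(2) by (simp add: \<phi>_def)
  qed auto
  then have "(envelope Y g \<rho> has_derivative (\<lambda>h. inner h (G (x, y) z))) (at (x, y))"
    by (simp add: gderiv_def envelope_def \<phi>_def case_prod_beta')
  moreover have "(x, y) \<in> U" using U y by auto
  ultimately show ?thesis
    unfolding gderiv_def residual_def inner_diff_right
    by (auto intro!: derivative_eq_intros g_der simp: G_def)
qed

lemma residual_not_stationary:
  fixes X :: "'a::euclidean_space set" and Y :: "'b::euclidean_space set"
  assumes Y: "compact Y"
    and U: "open U" "X \<times> Y \<subseteq> U"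
    and g_C1: "\<And>w. w \<in> U \<Longrightarrow> g differentiable (at w)" "continuous_on U (grad g)"
    and \<rho>: "\<rho> > 0" and \<delta>: "\<delta> > 0" and x: "x \<in> X"
    and conv: "convex_on Y (\<lambda>y. g (x, y))"
    and P: "affine_segments_constant Y (\<lambda>y. g (x, y))"
    and y: "y \<in> Y" and R: "residual Y g \<rho> \<delta> (x, y) \<ge> 0"
  shows "0 \<notin> {grad (residual Y g \<rho> \<delta>) (x, y) + v | v. v \<in> normal_cone (X \<times> Y) (x, y)}"
proof
  assume "0 \<in> {grad (residual Y g \<rho> \<delta>) (x, y) + v | v. v \<in> normal_cone (X \<times> Y) (x, y)}"
  then obtain v where v: "v \<in> normal_cone (X \<times> Y) (x, y)" "grad (residual Y g \<rho> \<delta>) (x, y) + v = 0"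
    by auto
  let ?k = "1 / (2 * \<rho>)"
  have gy: "GDERIV (\<lambda>y. g (x, y)) u :> snd (grad g (x, u))" if "u \<in> Y" for u
  proof -
    have "(g has_derivative (\<lambda>h. inner h (grad g (x, u)))) (at (x, u))"
      using differentiable_GDERIV_grad[OF g_C1(1)] U x that unfolding gderiv_def by auto
    from has_derivative_compose[of "\<lambda>u. (x, u)" "\<lambda>h. (0, h)" u UNIV, OF _ this]
    show ?thesis
      by (simp add: gderiv_def inner_prod_def has_derivative_Pair[OF has_derivative_const has_derivative_ident])
  qed
  have cont: "continuous_on Y (\<lambda>u. g (x, u))"
    using gy unfolding gderiv_def by (blast intro: has_derivative_continuous continuous_at_imp_continuous_on)
  then have "continuous_on Y (\<lambda>u. g (x, u) + ?k * (norm (u - y))\<^sup>2)"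
    by (intro continuous_intros)
  from continuous_attains_inf[OF Y _ this] y obtain z where z: "z \<in> Y" and
    min: "\<And>u. u \<in> Y \<Longrightarrow> g (x, z) + ?k * (norm (z - y))\<^sup>2 \<le> g (x, u) + ?k * (norm (u - y))\<^sup>2"
    by blast
  define c where "c = - (norm (z - y))\<^sup>2 / \<rho>"
  have c_eq: "inner ((1 / \<rho>) *\<^sub>R (y - z)) (z - y) = c" "inner ((1 / \<rho>) *\<^sub>R (z - y)) (y - z) = c"
    by (simp_all add: c_def power2_norm_eq_inner inner_diff_left inner_diff_right inner_commute
        diff_divide_distrib add_divide_distrib)
  have xY: "{x} \<times> Y \<subseteq> U" using U(2) x by auto
  have "v = - (grad g (x, y) - (fst (grad g (x, z)), (1 / \<rho>) *\<^sub>R (y - z)))"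
    using v(2) grad_eqI[OF GDERIV_residual[OF Y U(1) xY g_C1 conv \<rho> y z min], of \<delta>]
    by (metis add.commute eq_neg_iff_add_eq_0)
  \<comment> \<open>The normal cone is tested at \<open>(x, z)\<close>, a point of the product; the
    direction has zero first component, so the \<open>x\<close>-part of the gradient drops
    out.\<close>
  moreover have "inner v ((x, z) - (x, y)) \<le> 0"
    using v(1) x y z unfolding normal_cone_def by (auto split: if_splits)
  ultimately have "inner ((1 / \<rho>) *\<^sub>R (y - z) - snd (grad g (x, y))) (z - y) \<le> 0"
    by (simp only: inner_prod_def) simp
  then have "c \<le> inner (snd (grad g (x, y))) (z - y)"
    using c_eq by (simp add: inner_diff_left)
  with convex_on_above_GDERIV[OF conv y z gy[OF y]]
  have 0: "g (x, y) + c \<le> g (x, z)" by simp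
  \<comment> \<open>Optimality of \<open>z\<close> in the direction of \<open>y\<close>: the
    objective is negated so that minimality becomes an upper chord bound with \<open>c\<close> equal
    to 0.\<close>
  have "inner (- snd (grad g (x, z)) - (1 / \<rho>) *\<^sub>R (z - y)) (y - z) \<le> 0"
  proof (rule GDERIV_le_of_chord_le)
    show "GDERIV (\<lambda>u. - (g (x, u) + ?k * (norm (u - y))\<^sup>2)) z :> - snd (grad g (x, z)) - (1 / \<rho>) *\<^sub>R (z - y)"
      using gy[OF z] \<rho> unfolding gderiv_def power2_norm_eq_inner
      by (auto intro!: derivative_eq_intros simp: fun_eq_iff inner_commute inner_diff_left inner_diff_right
          inner_add_right field_simps)
    fix t :: real assume "t \<in> {0<..<1}"
    then have "z + t *\<^sub>R (y - z) \<in> Y"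
      using convexD_alt[OF convex_on_imp_convex[OF conv] z y, of t] by (simp add: algebra_simps)
    from min[OF this]
    show "- (g (x, z + t *\<^sub>R (y - z)) + ?k * (norm (z + t *\<^sub>R (y - z) - y))\<^sup>2)
      \<le> - (g (x, z) + ?k * (norm (z - y))\<^sup>2) + t * 0" by simp
  qed
  then have 1: "- c \<le> inner (snd (grad g (x, z))) (y - z)"
    using c_eq by (simp add: inner_diff_left)
  have 2: "g (x, z) + inner (snd (grad g (x, z))) (u - z) \<le> g (x, u)" if "u \<in> Y" for u
    using convex_on_above_GDERIV[OF conv z that gy[OF z]] .
  \<comment> \<open>The tangent at \<open>y\<close> gives one inequality, and the tangent at
    \<open>z\<close>, evaluated at \<open>y\<close>, gives the other.\<close>
  have slope: "g (x, z) = g (x, y) + c"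
    using 0 1 2[OF y] by linarith
  \<comment> \<open>The chord from \<open>y\<close> to \<open>z\<close> bounds from above. The
    tangent at \<open>z\<close> bounds from below, and by \<open>slope\<close> and \<open>1\<close>
    it lies on or above the same line.\<close>
  have aff: "g (x, (1 - t) *\<^sub>R y + t *\<^sub>R z) = g (x, y) + c * t" if t: "t \<in> {0..1}" for t
  proof (rule antisym)
    show "g (x, (1 - t) *\<^sub>R y + t *\<^sub>R z) \<le> g (x, y) + c * t"
      using convex_onD[OF conv, of t y z] t y z by (simp add: slope algebra_simps)
    have u: "(1 - t) *\<^sub>R y + t *\<^sub>R z \<in> Y"
      using convexD_alt[OF convex_on_imp_convex[OF conv] y z] t by simp
    have eq: "(1 - t) *\<^sub>R y + t *\<^sub>R z - z = (1 - t) *\<^sub>R (y - z)" by (simp add: algebra_simps)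
    have "(1 - t) * - c \<le> (1 - t) * inner (snd (grad g (x, z))) (y - z)"
      using 1 t by (intro mult_left_mono) auto
    then show "g (x, y) + c * t \<le> g (x, (1 - t) *\<^sub>R y + t *\<^sub>R z)"
      using 2[OF u] unfolding eq slope by (simp add: algebra_simps)
  qed
  then have "(\<lambda>t. g (x, (1 - t) *\<^sub>R y + t *\<^sub>R z)) constant_on {0..1}"
    using P y z unfolding affine_segments_constant_def affine_fun_on_def by blast
  then obtain k where k: "\<And>t. t \<in> {0..1} \<Longrightarrow> g (x, (1 - t) *\<^sub>R y + t *\<^sub>R z) = k"
    unfolding constant_on_def by blast
  have "c = 0" using aff[of 0] aff[of 1] k[of 0] k[of 1] by simp
  then have "z = y" using \<rho> by (simp add: c_def)
  have "envelope Y g \<rho> (x, y) = g (x, z) + ?k * (norm (z - y))\<^sup>2"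
    unfolding envelope_def using z min by (auto intro!: cInf_eq_minimum)
  then show False using R \<delta> \<open>z = y\<close> by (simp add: residual_def)
qed

section \<open>Strict convexity implies convexity and property (P)\<close>

lemma strictly_convex_indicator_less:
  assumes f: "strictly_convex (\<lambda>y. ereal (f y) + indicator_fun Y y)"
    and Y: "convex Y" "y \<in> Y" "z \<in> Y" "y \<noteq> z" and t: "t \<in> {0<..<1}"
  shows "f ((1 - t) *\<^sub>R y + t *\<^sub>R z) < (1 - t) * f y + t * f z"
proof -
  have m: "(1 - t) *\<^sub>R y + t *\<^sub>R z \<in> Y"
    using convexD_alt[OF Y(1-3)] t by simp
  show ?thesis
    using f[unfolded strictly_convex_def, rule_format, OF t, of y z] Y m by (simp add: indicator_fun_def)
qed

lemma strictly_convex_indicator_imp_convex_on: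
  assumes "strictly_convex (\<lambda>y. ereal (f y) + indicator_fun Y y)" and "convex Y"
  shows "convex_on Y f"
proof (rule convex_onI)
  fix t :: real and y z assume *: "0 < t" "t < 1" "y \<in> Y" "z \<in> Y"
  show "f ((1 - t) *\<^sub>R y + t *\<^sub>R z) \<le> (1 - t) * f y + t * f z"
  proof (cases "y = z")
    case True
    then show ?thesis by (simp add: algebra_simps)
  next
    case False
    then show ?thesis
      using strictly_convex_indicator_less[OF assms, of y z t] * by simp
  qed
qed (fact assms(2))

text \<open>An affine restriction attains equality at the midpoint, contradicting strictness unless
  the endpoints coincide; the segment is then a single point.\<close>

lemma strictly_convex_indicator_imp_affine_segments_constant:
  assumes "strictly_convex (\<lambda>y. ereal (f y) + indicator_fun Y y)" and "convex Y"
  shows "affine_segments_constant Y f"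
  unfolding affine_segments_constant_def
proof (intro ballI impI)
  fix y z assume yz: "y \<in> Y" "z \<in> Y"
    and "affine_fun_on {0..1} (\<lambda>t. f ((1 - t) *\<^sub>R y + t *\<^sub>R z))"
  then obtain a b where ab: "\<And>t. t \<in> {0..1} \<Longrightarrow> f ((1 - t) *\<^sub>R y + t *\<^sub>R z) = a + b * t"
    unfolding affine_fun_on_def by blast
  have "y = z"
  proof (rule ccontr)
    assume "y \<noteq> z"
    from strictly_convex_indicator_less[OF assms yz this, of "1/2"] ab[of 0] ab[of 1] ab[of "1/2"]
    show False by simp
  qed
  then show "(\<lambda>t. f ((1 - t) *\<^sub>R y + t *\<^sub>R z)) constant_on {0..1}"
    by (auto simp: constant_on_def scaleR_left_distrib[symmetric])
qed

theorem proposition15: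
  fixes X :: "(real ^ 'n) set" and Y :: "(real ^ 'm) set"
    and U :: "((real ^ 'n) \<times> (real ^ 'm)) set"
    and g :: "(real ^ 'n) \<times> (real ^ 'm) \<Rightarrow> real"
    and \<sigma> \<rho> \<delta> :: real
  assumes X: "X \<noteq> {}" "compact X" "convex X"
    and Y: "Y \<noteq> {}" "compact Y" "convex Y"
    and U: "open U" "X \<times> Y \<subseteq> U"
    and g_C1: "\<And>w. w \<in> U \<Longrightarrow> g differentiable (at w)" "continuous_on U (grad g)"
    and g_Lipschitz: "\<exists>L. L-lipschitz_on (X \<times> Y) (grad g)"
    and \<sigma>: "\<sigma> \<ge> 0"
      "\<And>x. x \<in> X \<Longrightarrow> convex_on Y (\<lambda>y. g (x, y) + \<sigma> / 2 * (norm y)\<^sup>2)"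
    and \<rho>: "\<rho> > 0" "\<rho> * \<sigma> < 1"
    and \<delta>: "\<delta> > 0"
  shows "(\<forall>x\<in>X.
           convex_on Y (\<lambda>y. g (x, y)) \<and> affine_segments_constant Y (\<lambda>y. g (x, y)) \<longrightarrow>
           (\<forall>y\<in>Y. residual Y g \<rho> \<delta> (x, y) \<ge> 0 \<longrightarrow>
              0 \<notin> {grad (residual Y g \<rho> \<delta>) (x, y) + v | v. v \<in> normal_cone (X \<times> Y) (x, y)})) \<and>
         ((\<forall>x\<in>X.
           convex_on Y (\<lambda>y. g (x, y)) \<and> affine_segments_constant Y (\<lambda>y. g (x, y))) \<longrightarrow>
           ENNAMCQ (X \<times> Y) (residual Y g \<rho> \<delta>)) \<and>
         ((\<forall>x\<in>X. strictly_convex (\<lambda>y. ereal (g (x, y)) + indicator_fun Y y)) \<longrightarrow>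
           ENNAMCQ (X \<times> Y) (residual Y g \<rho> \<delta>))"
proof -
  let ?good = "\<lambda>x. convex_on Y (\<lambda>y. g (x, y)) \<and> affine_segments_constant Y (\<lambda>y. g (x, y))"
  have stat: "0 \<notin> {grad (residual Y g \<rho> \<delta>) (x, y) + v | v. v \<in> normal_cone (X \<times> Y) (x, y)}"
    if "x \<in> X" "?good x" "y \<in> Y" "residual Y g \<rho> \<delta> (x, y) \<ge> 0" for x y
    using that residual_not_stationary[OF Y(2) U g_C1 \<rho>(1) \<delta>] by blast
  have ENNAMCQ: "ENNAMCQ (X \<times> Y) (residual Y g \<rho> \<delta>)" if good: "\<forall>x\<in>X. ?good x"
    unfolding ENNAMCQ_def
  proof (intro ballI impI)
    fix w assume "w \<in> X \<times> Y" and R: "residual Y g \<rho> \<delta> w \<ge> 0"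
    then obtain x y where "w = (x, y)" "x \<in> X" "y \<in> Y" by blast
    with stat[of x y] good R
    show "0 \<notin> {grad (residual Y g \<rho> \<delta>) w + v | v. v \<in> normal_cone (X \<times> Y) w}" by blast
  qed
  have "\<forall>x\<in>X. ?good x" if "\<forall>x\<in>X. strictly_convex (\<lambda>y. ereal (g (x, y)) + indicator_fun Y y)"
    using that Y(3)
    by (auto intro: strictly_convex_indicator_imp_convex_on
        strictly_convex_indicator_imp_affine_segments_constant)
  with stat ENNAMCQ show ?thesis by blast
qed

end
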